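(* Let $[a,b]\subset\mathbb{R}$ be an interval and let $k\ge 6$ be an integer. Then $$ m\left([a,b]\cap\bigcup_{k^{n-1}<q\le k^n}\ \bigcup_{p\in\mathbb{Z}} B\!\left(\frac{p}{q},\frac{k}{k^{2n}}\right)\right)\ \ge\ \frac12\,(b-a) $$ for all sufficiently large $n\in\mathbb{N}$ (the union over $q$ ranges over integers $q$).
   Context: $m$ denotes one-dimensional Lebesgue measure on $\mathbb{R}$, and for $x\in\mathbb{R}$, $r>0$, $B(x,r)=(x-r,x+r)$. *)

theory Defs
  imports "HOL-Analysis.Analysis"
begin

end

theory Submission
  imports Defs
begin

text \<open>
  By Dirichlet, every real \<open>x\<close> lies within \<open>1 / (q N)\<close> of some \<open>p / q\<close> with
  \<open>1 \<le> q \<le> N = k ^ n\<close>. If \<open>q > k ^ (n - 1)\<close>, this distance is below \<open>k / k ^ (2 n)\<close>. Hence the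
  points of \<open>[a, b]\<close> missed by the union are covered by the intervals of radius \<open>1 / (q N)\<close> around
  the \<open>p / q\<close> with \<open>q \<le> Q = k ^ (n - 1)\<close>. For each \<open>q\<close> at most \<open>q (b - a) + 3\<close> of these meet
  \<open>[a, b]\<close>, so the missed set has measure at most \<open>2 (b - a) Q / N + 6 H / N\<close>, where \<open>H\<close> is the
  \<open>Q\<close>-th harmonic number. The first term is \<open>2 (b - a) / k \<le> (b - a) / 3\<close> and the second one
  tends to \<open>0\<close>.
\<close>

text \<open>The difference \<open>harm n - ln n\<close> converges to the Euler-Mascheroni constant,
  so after division by \<open>n\<close> it vanishes in the limit, as does
  \<open>ln n / n\<close>.\<close>

lemma harm_over_n_tendsto_0: "(\<lambda>n. harm n / real n) \<longlonglongrightarrow> 0"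
proof -
  have "(\<lambda>n. (harm n - ln (real n)) / real n + ln (real n) / real n) \<longlonglongrightarrow> 0 + 0"
    by (intro tendsto_add lim_ln_over_n tendsto_divide_0[OF euler_mascheroni_LIMSEQ]
          filterlim_at_top_imp_at_infinity filterlim_real_sequentially)
  then show ?thesis
    by (simp add: add_divide_distrib[symmetric])
qed

lemma int_between_eq_atLeastAtMost:
  fixes u v :: real
  shows "{p :: int. u < p \<and> p < v} = {\<lfloor>u\<rfloor> + 1..\<lceil>v\<rceil> - 1}"
  by auto linarith+

lemma card_int_between_le:
  fixes u v :: real
  assumes "u \<le> v"
  shows "real (card {p :: int. u < of_int p \<and> of_int p < v}) \<le> v - u + 1"
  using assms unfolding int_between_eq_atLeastAtMost by simp linarith

text \<open>\<open>P\<close> collects the numerators whose ball meets \<open>{a..b}\<close>. They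
  lie in a window of length \<open>q * (b - a) + 2 * r\<close>, so \<open>r \<le> 1\<close> leaves
  at most \<open>q * (b - a) + 3\<close> of them, and each ball has length
  \<open>2 * r / q\<close>.\<close>

lemma measure_near_rationals_le:
  fixes a b r :: real and q :: nat
  assumes "a \<le> b" "0 < q" "0 \<le> r" "r \<le> 1"
  defines "P \<equiv> {p :: int. q * a - r < p \<and> p < q * b + r}"
  shows "measure lebesgue (\<Union>p\<in>P. ball (p / q) (r / q)) \<le> 2 * r * (b - a) + 6 * r / q"
proof -
  have fin: "finite P"
    unfolding P_def int_between_eq_atLeastAtMost by simp
  have "real q * a \<le> real q * b"
    using assms by (intro mult_left_mono) auto
  then have card: "real (card P) \<le> q * (b - a) + 3"
    using card_int_between_le[of "q * a - r" "q * b + r"] \<open>0 \<le> r\<close> \<open>r \<le> 1\<close>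
    unfolding P_def by (simp add: algebra_simps)
  have "measure lebesgue (\<Union>p\<in>P. ball (p / q) (r / q))
      \<le> (\<Sum>p\<in>P. measure lebesgue (ball (of_int p / real q) (r / q)))"
    using fin by (intro measure_UNION_le) auto
  also have "\<dots> = card P * (2 * r / q)"
    using assms by (simp add: ball_eq_greaterThanLessThan)
  also have "\<dots> \<le> (q * (b - a) + 3) * (2 * r / q)"
    using card assms by (intro mult_right_mono) auto
  also have "\<dots> = 2 * r * (b - a) + 6 * r / q"
    using assms by (simp add: field_simps)
  finally show ?thesis .
qed

text \<open>With the same \<open>r\<close> for every \<open>q\<close>, the main terms add up to
  \<open>Q\<close> equal copies, and only the boundary terms \<open>6 * r / q\<close> produce the
  harmonic number.\<close>

lemma measure_near_rationals_small_denominator_le: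
  fixes a b r :: real and Q :: nat
  assumes "a \<le> b" "0 \<le> r" "r \<le> 1"
  shows "measure lebesgue (\<Union>q\<in>{1..Q}. \<Union>p\<in>{p :: int. q * a - r < p \<and> p < q * b + r}.
           ball (p / real q) (r / q)) \<le> 2 * Q * r * (b - a) + 6 * r * harm Q"
    (is "measure lebesgue (\<Union>q\<in>_. ?E q) \<le> _")
proof -
  have "measure lebesgue (\<Union>q\<in>{1..Q}. ?E q) \<le> (\<Sum>q\<in>{1..Q}. measure lebesgue (?E q))"
    by (intro measure_UNION_le) (auto intro!: borel_open open_UN)
  also have "\<dots> \<le> (\<Sum>q\<in>{1..Q}. 2 * r * (b - a) + 6 * r / q)"
    using assms by (intro sum_mono measure_near_rationals_le) auto
  also have "\<dots> = 2 * Q * r * (b - a) + 6 * r * harm Q"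
    by (simp add: sum.distrib harm_def sum_distrib_left divide_inverse mult_ac)
  finally show ?thesis .
qed

lemma interval_subset_near_rationals:
  fixes a b :: real and Q N :: nat
  assumes "0 < Q" "0 < N"
  shows "{a..b} \<subseteq>
     (\<Union>q :: int \<in> {int Q <.. int N}. \<Union>p :: int. ball (p / q) (1 / (Q * N))) \<union>
     (\<Union>q\<in>{1..Q}. \<Union>p\<in>{p :: int. q * a - 1 / N < p \<and> p < q * b + 1 / N}.
           ball (p / real q) (1 / N / q))"
proof
  fix x assume x: "x \<in> {a..b}"
  obtain p q where q: "0 < q" "q \<le> int N" and pq: "\<bar>of_int q * x - of_int p\<bar> < 1 / N"
    using Dirichlet_approx[OF \<open>0 < N\<close>] by blast
  have "\<bar>x - p / q\<bar> = \<bar>of_int q * x - of_int p\<bar> / q"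
    using q by (simp add: divide_simps abs_mult) (simp add: abs_if mult_ac)
  also have "\<dots> < 1 / N / q"
    using q pq by (intro divide_strict_right_mono) auto
  finally have dist: "\<bar>p / q - x\<bar> < 1 / N / q"
    by (simp add: abs_minus_commute)
  show "x \<in> (\<Union>q :: int \<in> {int Q <.. int N}. \<Union>p :: int. ball (p / q) (1 / (Q * N))) \<union>
     (\<Union>q\<in>{1..Q}. \<Union>p\<in>{p :: int. q * a - 1 / N < p \<and> p < q * b + 1 / N}.
           ball (p / real q) (1 / N / q))"
  proof (cases "q > int Q")
    case True
    then have "real Q \<le> of_int q"
      by linarith
    then have "1 / N / of_int q \<le> 1 / (Q * N)"
      using assms q by (simp add: frac_le mult.commute)
    then show ?thesis
      using True q dist by (auto simp: dist_real_def intro!: bexI[of _ q] exI[of _ p])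
  next
    case False
    define m where "m = nat q"
    have m: "q = int m" "m \<in> {1..Q}"
      using False q by (auto simp: m_def)
    \<comment> \<open>Since \<open>m * x\<close> lies in \<open>[m * a, m * b]\<close> and
      \<open>p\<close> is within \<open>1 / N\<close> of it, \<open>p\<close> falls into the finite
      window of numerators.\<close>
    have "real m * a \<le> m * x" "m * x \<le> real m * b"
      using x by (auto intro!: mult_left_mono)
    then have "m * a - 1 / N < p" "p < m * b + 1 / N"
      using pq unfolding m by auto
    then show ?thesis
      using m dist by (auto simp: dist_real_def intro!: bexI[of _ m] exI[of _ p])
  qed
qed

text \<open>Subadditivity applied to the covering: what the small denominators cannot cover is left
  to the large ones.\<close>

lemma measure_near_rationals_large_denominator_ge:
  fixes a b :: real and Q N :: nat
  assumes "a \<le> b" "0 < Q" "0 < N"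
  shows "measure lebesgue ({a..b} \<inter>
       (\<Union>q :: int \<in> {int Q <.. int N}. \<Union>p :: int. ball (p / q) (1 / (Q * N))))
     \<ge> (b - a) - 2 * Q / N * (b - a) - 6 * harm Q / N"
    (is "measure lebesgue (_ \<inter> ?G) \<ge> _")
proof -
  define E where "E = (\<Union>q\<in>{1..Q}. \<Union>p\<in>{p :: int. q * a - 1 / N < p \<and> p < q * b + 1 / N}.
           ball (p / real q) (1 / N / q))"
  have G: "?G \<in> sets lebesgue" and E: "E \<in> sets lebesgue"
    unfolding E_def by (auto intro!: borel_open open_UN)
  have "{a..b} = ({a..b} \<inter> ?G) \<union> ({a..b} \<inter> E)"
    using interval_subset_near_rationals[OF assms(2,3), of a b] unfolding E_def by blast
  then have "b - a = measure lebesgue (({a..b} \<inter> ?G) \<union> ({a..b} \<inter> E))"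
    using \<open>a \<le> b\<close> by (metis measure_completion measure_lborel_Icc sets_lborel
        lborelD borel_closed closed_atLeastAtMost)
  also have "\<dots> \<le> measure lebesgue ({a..b} \<inter> ?G) + measure lebesgue ({a..b} \<inter> E)"
    using G E by (intro measure_Un_le) auto
  \<comment> \<open>\<open>measure\<close> is 0 on sets of infinite measure, so monotonicity
    requires \<open>E\<close> to have finite measure; finitely many balls ensure this.\<close>
  also have "measure lebesgue ({a..b} \<inter> E) \<le> measure lebesgue E"
  proof (intro measure_mono_fmeasurable)
    have "finite {p :: int. q * a - 1 / N < p \<and> p < q * b + 1 / N}" for q :: nat
      unfolding int_between_eq_atLeastAtMost by simp
    then show "E \<in> lmeasurable"
      unfolding E_def by (intro fmeasurable.finite_UN) auto
  qed (use E in auto)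
  also have "measure lebesgue E \<le> 2 * Q / N * (b - a) + 6 * harm Q / N"
    using measure_near_rationals_small_denominator_le[OF \<open>a \<le> b\<close>, of "1 / N" Q] \<open>0 < N\<close>
    by (simp add: E_def)
  finally show ?thesis
    by simp
qed

theorem theorem1p3:
  fixes a b :: real and k :: int
  assumes "a \<le> b" and "k \<ge> 6"
  shows "\<forall>\<^sub>F n :: nat in sequentially.
    measure lebesgue
      ({a..b} \<inter> (\<Union>q :: int \<in> {k ^ (n - 1) <.. k ^ n}. \<Union>p :: int.
         ball (real_of_int p / real_of_int q) (real_of_int k / real_of_int k ^ (2 * n))))
    \<ge> 1 / 2 * (b - a)"
proof (cases "a = b")
  case True
  then show ?thesis
    by simp
next
  case False
  with \<open>a \<le> b\<close> have "a < b"
    by simp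
  define K where "K = nat k"
  have K: "k = int K" "K \<ge> 6"
    using \<open>k \<ge> 6\<close> by (auto simp: K_def)
  have "filterlim (\<lambda>n. K ^ n) sequentially sequentially"
    using K by (intro filterlim_subseq) (auto simp: strict_mono_def power_strict_increasing)
  then have "(\<lambda>n. harm (K ^ n) / real (K ^ n)) \<longlonglongrightarrow> 0"
    by (rule filterlim_compose[OF harm_over_n_tendsto_0])
  \<comment> \<open>The threshold comes from the budget 1 - 1/3 - 1/6 = 1/2.\<close>
  then have "\<forall>\<^sub>F n in sequentially. harm (K ^ n) / real (K ^ n) < (b - a) / 6"
    using \<open>a < b\<close> by (intro order_tendstoD) auto
  \<comment> \<open>Passing to \<open>Suc n\<close> avoids the truncated \<open>n - 1\<close> at 0
    and gives \<open>Q = K ^ n\<close> and \<open>N = K * Q\<close>.\<close>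
  then have "\<forall>\<^sub>F n in sequentially. 1 / 2 * (b - a) \<le> measure lebesgue
      ({a..b} \<inter> (\<Union>q :: int \<in> {k ^ (Suc n - 1) <.. k ^ Suc n}. \<Union>p :: int.
         ball (real_of_int p / real_of_int q) (real_of_int k / real_of_int k ^ (2 * Suc n))))"
  proof eventually_elim
    case (elim n)
    define Q where "Q = K ^ n"
    have Q: "0 < Q"
      using K by (simp add: Q_def)
    have rad: "1 / (real Q * real (K * Q)) = real_of_int k / real_of_int k ^ (2 * Suc n)"
      using K by (simp add: Q_def field_simps power_mult_distrib flip: power_add power_mult)
    \<comment> \<open>Both bounds rest on \<open>K \<ge> 6\<close>: the factors are
      \<open>2 / K \<le> 1 / 3\<close> here and \<open>6 / K \<le> 1\<close> in the next
      one.\<close>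
    have "2 * Q / (K * Q) * (b - a) \<le> 1 / 3 * (b - a)"
      using K Q \<open>a < b\<close> by (intro mult_right_mono) (auto simp: field_simps)
    moreover have "6 * harm Q / (K * Q) \<le> harm Q / real Q"
      using K Q harm_nonneg[of Q, where ?'a = real] by (simp add: field_simps mult_right_mono)
    ultimately have "1 / 2 * (b - a) \<le> (b - a) - 2 * Q / (K * Q) * (b - a) - 6 * harm Q / (K * Q)"
      using elim unfolding Q_def by argo
    also have "\<dots> \<le> measure lebesgue ({a..b} \<inter> (\<Union>q :: int \<in> {int Q <.. int (K * Q)}.
        \<Union>p :: int. ball (p / q) (1 / (Q * real (K * Q)))))"
      using measure_near_rationals_large_denominator_ge[OF \<open>a \<le> b\<close> Q, of "K * Q"] K Q by simp
    finally show ?case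
      unfolding rad by (simp add: K Q_def)
  qed
  then show ?thesis
    by (rule eventually_sequentially_Suc[THEN iffD1])
qed

end
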